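(* Let $\mathcal{D}$ be a fixed distribution supported on $[0,1]$ (not depending on $n$ or $m$) with mean $\mu$ and variance $s^2$. Then for every $\epsilon>0$ there exists $n_0$ such that for all $n\ge n_0$, all $m$, every preference profile $\sigma$ on $n$ voters and $m$ alternatives, and every expected-welfare-maximizing rule $f$ for $\mathcal{D}$, $$\mathbb{E}[\mathrm{dist}(f(\sigma),\sigma)]\ge(1-\epsilon)\max_{j\in A}\mathbb{E}[\mathrm{dist}(j,\sigma)].$$ Furthermore, if $\mathcal{D}$ has a continuously differentiable CDF $F$ satisfying $\frac{dF}{dx}(x)>0$ for $x\in(0,1)$, then for every $\epsilon>0$ there exists $m_0$ such that the same conclusion holds for all $m\ge m_0$ and all $n$.
   Context: There are $n$ voters and $m$ alternatives $A=\{1,\dots,m\}$. A preference profile $\sigma$ consists of a ranking of $A$ for each voter. A (deterministic) voting rule maps each preference profile to an alternative. Given a distribution $\mathcal{D}$ and a profile $\sigma$, a random utility profile $u$ consistent with $\sigma$ is generated as follows: independently for each voter $i$, draw $m$ i.i.d. samples from $\mathcal{D}$ and assign them, from highest to lowest, to the alternatives in the order of voter $i$'s ranking. The social welfare of $j$ is $\mathrm{sw}(j,u)=\sum_i u_{ij}$; expectations are over this random $u$. The distortion of $j$ at $\sigma$ is $\mathrm{dist}(j,\sigma)=\mathrm{sw}(j,u)/\max_{k\in A}\mathrm{sw}(k,u)$. A rule is an expected-welfare-maximizing rule for $\mathcal{D}$ if for every profile $\sigma$ it selects an alternative maximizing $\mathbb{E}[\mathrm{sw}(j,u)]$ over $j\in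 A$. *)

theory Defs
  imports "HOL-Probability.Probability"
begin

text \<open>Alternatives are 1..m, voters are 1..n.  A preference profile is encoded by
  the rank function: sigma i j is the position (1 = top) of alternative j in voter i's
  ranking; for each voter it is a bijection of {1..m}.\<close>
definition is_profile :: "nat \<Rightarrow> nat \<Rightarrow> (nat \<Rightarrow> nat \<Rightarrow> nat) \<Rightarrow> bool" where
  "is_profile n m \<sigma> \<longleftrightarrow> (\<forall>i\<in>{1..n}. bij_betw (\<sigma> i) {1..m} {1..m})"

definition sample_space :: "real measure \<Rightarrow> nat \<Rightarrow> nat \<Rightarrow> (nat \<times> nat \<Rightarrow> real) measure" where
  "sample_space D n m = (\<Pi>\<^sub>M p\<in>{1..n} \<times> {1..m}. D)"

definition kth_largest :: "nat \<Rightarrow> (nat \<Rightarrow> real) \<Rightarrow> nat \<Rightarrow> real" where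
  "kth_largest m x r = rev (sort (map x [1..<m+1])) ! (r - 1)"

text \<open>Random utility profile consistent with sigma: the samples of voter i, sorted from
  highest to lowest, are assigned to the alternatives in the order of voter i's ranking.\<close>
definition util :: "nat \<Rightarrow> (nat \<Rightarrow> nat \<Rightarrow> nat) \<Rightarrow> (nat \<times> nat \<Rightarrow> real) \<Rightarrow> nat \<Rightarrow> nat \<Rightarrow> real" where
  "util m \<sigma> X i j = kth_largest m (\<lambda>k. X (i, k)) (\<sigma> i j)"

definition sw :: "nat \<Rightarrow> nat \<Rightarrow> (nat \<Rightarrow> nat \<Rightarrow> nat) \<Rightarrow> (nat \<times> nat \<Rightarrow> real) \<Rightarrow> nat \<Rightarrow> real" where
  "sw n m \<sigma> X j = (\<Sum>i\<in>{1..n}. util m \<sigma> X i j)"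

definition distortion :: "nat \<Rightarrow> nat \<Rightarrow> (nat \<Rightarrow> nat \<Rightarrow> nat) \<Rightarrow> nat \<Rightarrow> (nat \<times> nat \<Rightarrow> real) \<Rightarrow> real" where
  "distortion n m \<sigma> j X = sw n m \<sigma> X j / Max ((\<lambda>k. sw n m \<sigma> X k) ` {1..m})"

definition exp_sw :: "real measure \<Rightarrow> nat \<Rightarrow> nat \<Rightarrow> (nat \<Rightarrow> nat \<Rightarrow> nat) \<Rightarrow> nat \<Rightarrow> real" where
  "exp_sw D n m \<sigma> j = (\<integral>X. sw n m \<sigma> X j \<partial>sample_space D n m)"

definition exp_dist :: "real measure \<Rightarrow> nat \<Rightarrow> nat \<Rightarrow> (nat \<Rightarrow> nat \<Rightarrow> nat) \<Rightarrow> nat \<Rightarrow> real" where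
  "exp_dist D n m \<sigma> j = (\<integral>X. distortion n m \<sigma> j X \<partial>sample_space D n m)"

definition ewm_rule :: "real measure \<Rightarrow> nat \<Rightarrow> nat \<Rightarrow> ((nat \<Rightarrow> nat \<Rightarrow> nat) \<Rightarrow> nat) \<Rightarrow> bool" where
  "ewm_rule D n m f \<longleftrightarrow> (\<forall>\<sigma>. is_profile n m \<sigma> \<longrightarrow>
      f \<sigma> \<in> {1..m} \<and> (\<forall>k\<in>{1..m}. exp_sw D n m \<sigma> k \<le> exp_sw D n m \<sigma> (f \<sigma>)))"

end

theory Submission
  imports Defs "HOL-Real_Asymp.Real_Asymp"
begin

text \<open>
  Let \<open>S\<^sub>j\<close> be the welfare of alternative \<open>j\<close>, \<open>w\<close> the chosen alternative and \<open>T\<close> the largest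
  welfare. The welfares sum to the sum of all samples, so \<open>E S\<^sub>w \<ge> n \<mu>\<close>. Since \<open>E S\<^sub>j \<le> E S\<^sub>w\<close>,
  almost surely
  \<open>S\<^sub>j / T - S\<^sub>w / T \<le> 2 / (n \<mu>) * (\<bar>S\<^sub>j - E S\<^sub>j\<bar> + \<bar>S\<^sub>w - E S\<^sub>w\<bar>)\<close>;
  when \<open>T < n \<mu> / 2\<close>, this holds because the deviation of \<open>S\<^sub>w\<close> alone exceeds \<open>n \<mu> / 2\<close>.
  So no control of \<open>T\<close> is needed, and it suffices that \<open>E \<bar>S\<^sub>j - E S\<^sub>j\<bar> = o(n)\<close> uniformly. For
  many voters this is Hoeffding's inequality over the independent voters. For many alternatives
  Hoeffding's inequality for the number of samples above a threshold puts every order statistic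
  near its quantile, uniformly in the rank because \<open>F\<close> increases by a uniform amount on all
  intervals of a fixed length in \<open>[0, 1]\<close>.
\<close>

section \<open>Order statistics through counts above a threshold\<close>

text \<open>In the ascending list the entries above \<open>t\<close> form a suffix, and the
  \<open>r\<close>-th largest entry sits at index \<open>m - r\<close>; it exceeds \<open>t\<close>
  exactly when that suffix has length at least \<open>r\<close>. Measurability and concentration of
  order statistics both reduce to such counts.\<close>

lemma kth_largest_gt_iff:
  assumes "r \<in> {1..m}"
  shows "t < kth_largest m x r \<longleftrightarrow> r \<le> card {k\<in>{1..m}. t < x k}"
proof -
  define l where "l = map x [1..<m+1]"
  define ys where "ys = sort l"
  have len: "length ys = m" by (simp add: ys_def l_def)
  have srt: "sorted ys" by (simp add: ys_def)
  have kth: "kth_largest m x r = ys ! (m - r)"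
    using assms by (cases r) (auto simp: kth_largest_def ys_def l_def rev_nth simp del: upt_Suc)
  have "card {k\<in>{1..m}. t < x k} = length (filter (\<lambda>y. t < y) l)"
  proof -
    have "length (filter (\<lambda>y. t < y) l) = length (filter (\<lambda>k. t < x k) [1..<m+1])"
      by (simp add: l_def filter_map o_def)
    also have "\<dots> = card (set (filter (\<lambda>k. t < x k) [1..<m+1]))"
      by (rule distinct_card[symmetric]) simp
    also have "set (filter (\<lambda>k. t < x k) [1..<m+1]) = {k\<in>{1..m}. t < x k}"
      by auto
    finally show ?thesis by simp
  qed
  also have "\<dots> = length (filter (\<lambda>y. t < y) ys)"
  proof -
    have "mset (filter (\<lambda>y. t < y) ys) = mset (filter (\<lambda>y. t < y) l)"
      by (simp add: ys_def)
    then show ?thesis by (metis size_mset)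
  qed
  also have "\<dots> = card {i. i < m \<and> t < ys ! i}"
    by (simp add: length_filter_conv_card len)
  finally have card_eq: "card {k\<in>{1..m}. t < x k} = card {i. i < m \<and> t < ys ! i}" .
  show ?thesis
  proof
    assume "t < kth_largest m x r"
    then have "{m - r..<m} \<subseteq> {i. i < m \<and> t < ys ! i}"
      using sorted_nth_mono[OF srt] len unfolding kth by force
    then have "card {m - r..<m} \<le> card {i. i < m \<and> t < ys ! i}"
      by (intro card_mono) auto
    then show "r \<le> card {k\<in>{1..m}. t < x k}"
      using assms card_eq by simp
  next
    assume r: "r \<le> card {k\<in>{1..m}. t < x k}"
    show "t < kth_largest m x r"
    proof (rule ccontr)
      assume "\<not> t < kth_largest m x r"
      then have le: "ys ! (m - r) \<le> t" by (simp add: kth)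
      have "m - r < i" if "i < m" "t < ys ! i" for i
      proof (rule ccontr)
        assume "\<not> m - r < i"
        then have "ys ! i \<le> ys ! (m - r)"
          using assms by (intro sorted_nth_mono[OF srt]) (auto simp: len)
        then show False using le that by linarith
      qed
      then have "{i. i < m \<and> t < ys ! i} \<subseteq> {m - r<..<m}" by auto
      then have "card {i. i < m \<and> t < ys ! i} \<le> card {m - r<..<m}"
        by (intro card_mono) auto
      then show False using r assms card_eq by auto
    qed
  qed
qed

text \<open>Sorting and reversing only permute the list. This trades order statistics for the
  samples themselves, whose means are all equal to that of the distribution.\<close>

lemma sum_kth_largest: "(\<Sum>r\<in>{1..m}. kth_largest m x r) = (\<Sum>k\<in>{1..m}. x k)"
proof -
  define ys where "ys = rev (sort (map x [1..<m+1]))"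
  have "(\<Sum>r\<in>{1..m}. kth_largest m x r) = (\<Sum>i<m. ys ! i)"
    by (rule sum.reindex_bij_witness[of _ Suc "\<lambda>r. r - 1"])
       (auto simp: kth_largest_def ys_def[symmetric] simp del: upt_Suc One_nat_def)
  also have "\<dots> = sum_list ys"
    by (simp add: sum_list_sum_nth ys_def atLeast0LessThan del: upt_Suc)
  also have "\<dots> = sum_list (map x [1..<m+1])"
    unfolding ys_def by (metis mset_rev mset_sort sum_mset_sum_list)
  also have "\<dots> = (\<Sum>k\<in>{1..m}. x k)"
    by (simp add: sum_list_distinct_conv_sum_set atLeastLessThanSuc_atLeastAtMost del: upt_Suc)
  finally show ?thesis .
qed

lemma kth_largest_mem:
  assumes "r \<in> {1..m}"
  shows "kth_largest m x r \<in> x ` {1..m}"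
proof -
  have "kth_largest m x r \<in> set (rev (sort (map x [1..<m+1])))"
    unfolding kth_largest_def using assms by (intro nth_mem) auto
  then show ?thesis by (simp add: atLeastLessThanSuc_atLeastAtMost del: upt_Suc)
qed

text \<open>As sums of indicators, counts become accessible to measurability rules and to
  Hoeffding's inequality.\<close>

lemma card_gt_eq_sum_indicator:
  "finite A \<Longrightarrow> real (card {k\<in>A. t < x k}) = (\<Sum>k\<in>A. indicator {t<..} (x k :: real))"
  by (simp add: indicator_def sum.If_cases Int_def conj_commute)

text \<open>By \<open>kth_largest_gt_iff\<close>, the superlevel set at \<open>t\<close> is an event
  about the number of entries above \<open>t\<close>, so \<open>sort\<close> need not be analysed as
  a measurable map.\<close>

lemma borel_measurable_kth_largest:
  assumes "r \<in> {1..m}" and "\<And>k. k \<in> {1..m} \<Longrightarrow> (\<lambda>\<omega>. x \<omega> k) \<in> borel_measurable N"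
  shows "(\<lambda>\<omega>. kth_largest m (x \<omega>) r) \<in> borel_measurable N"
proof (rule borel_measurable_iff_greater[THEN iffD2], rule allI)
  fix t
  have [measurable]: "(\<lambda>\<omega>. \<Sum>k\<in>{1..m}. indicator {t<..} (x \<omega> k) :: real) \<in> borel_measurable N"
    using assms(2) by (intro borel_measurable_sum) auto
  have "{\<omega> \<in> space N. t < kth_largest m (x \<omega>) r}
      = {\<omega> \<in> space N. real r \<le> (\<Sum>k\<in>{1..m}. indicator {t<..} (x \<omega> k))}"
    using assms(1) by (simp add: kth_largest_gt_iff flip: card_gt_eq_sum_indicator)
  also have "\<dots> \<in> sets N" by measurable
  finally show "{\<omega> \<in> space N. t < kth_largest m (x \<omega>) r} \<in> sets N" .
qed

section \<open>Hoeffding bounds for sums of variables in the unit interval\<close>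

text \<open>Each summand ranges over an interval of length 1, so the squared lengths add up to
  \<open>card I\<close>; inserting the deviation \<open>card I * \<eta>\<close> into Hoeffding's
  inequality gives the exponent.\<close>

lemma (in prob_space) prob_sum_deviation_le:
  fixes X :: "'i \<Rightarrow> 'a \<Rightarrow> real"
  assumes "finite I" "I \<noteq> {}" "indep_vars (\<lambda>_. borel) X I"
    and "\<And>i. i \<in> I \<Longrightarrow> AE x in M. X i x \<in> {0..1}" and "\<eta> \<ge> 0"
  shows "prob {x\<in>space M. real (card I) * \<eta> \<le> \<bar>(\<Sum>i\<in>I. X i x) - (\<Sum>i\<in>I. expectation (X i))\<bar>}
    \<le> 2 * exp (- 2 * real (card I) * \<eta>\<^sup>2)"
proof -
  interpret Hoeffding_ineq M I X "\<lambda>_. 0" "\<lambda>_. 1" "\<Sum>i\<in>I. expectation (X i)"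
    using assms by unfold_locales auto
  have "card I > 0" using assms by (simp add: card_gt_0_iff)
  then have "-2 * (real (card I) * \<eta>)\<^sup>2 / real (card I) = - 2 * real (card I) * \<eta>\<^sup>2"
    by (simp add: power2_eq_square)
  then show ?thesis
    using Hoeffding_ineq_abs_ge[of "real (card I) * \<eta>"] \<open>card I > 0\<close> assms(5) by simp
qed

lemma (in prob_space) integrable_AE_unit:
  assumes "Y \<in> borel_measurable M" "AE x in M. Y x \<in> {0..1::real}"
  shows "integrable M Y"
  using assms by (intro integrable_const_bound[where B = 1]) auto

text \<open>Off the event \<open>B\<close> of a large deviation, the deviation is below
  \<open>card I * \<eta>\<close>. On \<open>B\<close> it is at most \<open>card I\<close> by the
  triangle inequality, and Hoeffding bounds the probability of \<open>B\<close>.\<close>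

lemma (in prob_space) expectation_abs_sum_deviation_le:
  fixes X :: "'i \<Rightarrow> 'a \<Rightarrow> real"
  assumes fin: "finite I" and ne: "I \<noteq> {}" and ind: "indep_vars (\<lambda>_. borel) X I"
    and unit: "\<And>i. i \<in> I \<Longrightarrow> AE x in M. X i x \<in> {0..1}" and "\<eta> \<ge> 0"
  shows "expectation (\<lambda>x. \<bar>(\<Sum>i\<in>I. X i x) - expectation (\<lambda>x. \<Sum>i\<in>I. X i x)\<bar>)
    \<le> real (card I) * (\<eta> + 2 * exp (- 2 * real (card I) * \<eta>\<^sup>2))"
proof -
  define S where "S = (\<lambda>x. \<Sum>i\<in>I. X i x)"
  define c where "c = (\<Sum>i\<in>I. expectation (X i))"
  define B where "B = {x\<in>space M. real (card I) * \<eta> \<le> \<bar>S x - c\<bar>}"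
  have rv: "X i \<in> borel_measurable M" if "i \<in> I" for i
    using ind that by (auto simp: indep_vars_def)
  have int: "integrable M (X i)" if "i \<in> I" for i
    using rv unit that by (intro integrable_AE_unit) auto
  have intS: "integrable M S" unfolding S_def using int by simp
  have [measurable]: "S \<in> borel_measurable M" using intS by auto
  have B[measurable]: "B \<in> sets M" unfolding B_def by measurable
  have ES: "expectation S = c" unfolding S_def c_def using int by (simp add: integral_sum)
  have [simp]: "integrable M (indicat_real B)" by (rule integrable_real_indicator) (auto simp: less_top[symmetric])
  have EX: "0 \<le> expectation (X i) \<and> expectation (X i) \<le> 1" if "i \<in> I" for i
    using integral_nonneg_AE[of "X i" M] integral_le_const[OF int[OF that], of 1] unit[OF that]
    by (auto elim: eventually_mono)
  have AEX: "AE x in M. \<forall>i\<in>I. X i x \<in> {0..1}"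
    using unit fin by (intro AE_finite_allI) auto
  have "AE x in M. \<bar>S x - c\<bar> \<le> real (card I) * \<eta> + real (card I) * indicator B x"
    using AEX AE_space
  proof eventually_elim
    case (elim x)
    show ?case
    proof (cases "x \<in> B")
      case True
      have "\<bar>S x - c\<bar> = \<bar>\<Sum>i\<in>I. X i x - expectation (X i)\<bar>"
        by (simp add: S_def c_def sum_subtractf)
      also have "\<dots> \<le> (\<Sum>i\<in>I. \<bar>X i x - expectation (X i)\<bar>)" by (rule sum_abs)
      also have "\<dots> \<le> (\<Sum>i\<in>I. 1)"
      proof (rule sum_mono)
        fix i assume i: "i \<in> I"
        then have "X i x \<in> {0..1}" using elim by blast
        then show "\<bar>X i x - expectation (X i)\<bar> \<le> 1" using EX[OF i] by auto
      qed
      finally show ?thesis using True \<open>\<eta> \<ge> 0\<close> by (simp add: add_increasing)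
    next
      case False
      then show ?thesis using elim by (simp add: B_def)
    qed
  qed
  then have "expectation (\<lambda>x. \<bar>S x - c\<bar>)
      \<le> expectation (\<lambda>x. real (card I) * \<eta> + real (card I) * indicator B x)"
    using intS by (intro integral_mono_AE) (auto intro!: Bochner_Integration.integrable_add)
  also have "\<dots> = real (card I) * \<eta> + real (card I) * prob B"
    by (subst Bochner_Integration.integral_add) (auto simp: prob_space)
  also have "\<dots> \<le> real (card I) * \<eta> + real (card I) * (2 * exp (- 2 * real (card I) * \<eta>\<^sup>2))"
    unfolding B_def S_def c_def
    by (intro add_left_mono mult_left_mono prob_sum_deviation_le assms) auto
  finally show ?thesis using ES by (simp add: S_def algebra_simps)
qed

section \<open>Samples, utilities and welfares under the product measure\<close>

locale unit_interval_distribution = prob_space D for D :: "real measure" +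
  assumes sets_D [measurable_cong]: "sets D = sets borel"
    and AE_unit: "AE x in D. x \<in> {0..1}"
begin

abbreviation \<mu> :: real where "\<mu> \<equiv> expectation (\<lambda>x. x)"

lemma prob_space_sample_space: "prob_space (sample_space D n m)"
  unfolding sample_space_def by (intro prob_space_PiM prob_space_axioms)

lemma measurable_coord [measurable]:
  assumes "i \<in> {1..n}" "k \<in> {1..m}"
  shows "(\<lambda>X. X (i, k)) \<in> borel_measurable (sample_space D n m)"
  unfolding sample_space_def
  by (rule measurable_compose[OF measurable_component_singleton[of "(i, k)"]])
     (use assms in \<open>auto simp: measurable_ident_sets sets_D\<close>)

text \<open>Samples lie in the unit interval only almost surely. Later pointwise bounds assume this
  for all coordinates at once, and this lemma transfers them to almost every sample.\<close>

lemma AE_coords_unit: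
  "AE X in sample_space D n m. \<forall>p\<in>{1..n} \<times> {1..m}. X p \<in> {0..1}"
  unfolding sample_space_def
  by (intro AE_finite_allI AE_PiM_component[OF prob_space_axioms] AE_unit) auto

lemma distr_coord:
  assumes "i \<in> {1..n}" "k \<in> {1..m}"
  shows "distr (sample_space D n m) D (\<lambda>X. X (i, k)) = D"
  unfolding sample_space_def
  using distr_PiM_component[of "{1..n} \<times> {1..m}" "\<lambda>_. D" "(i, k)"] assms prob_space_axioms by simp

lemma expectation_coord:
  assumes "i \<in> {1..n}" "k \<in> {1..m}" and "g \<in> borel_measurable borel"
  shows "(\<integral>X. g (X (i, k)) \<partial>sample_space D n m) = (\<integral>x. (g x :: real) \<partial>D)"
proof -
  have "(\<integral>x. g x \<partial>D) = (\<integral>x. g x \<partial>distr (sample_space D n m) D (\<lambda>X. X (i, k)))"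
    by (simp only: distr_coord[OF assms(1,2)])
  also have "\<dots> = (\<integral>X. g (X (i, k)) \<partial>sample_space D n m)"
    using assms measurable_coord[OF assms(1,2)]
    by (intro integral_distr) (auto simp: measurable_cong_sets[OF refl sets_D] measurable_cong_sets[OF sets_D refl])
  finally show ?thesis by simp
qed

text \<open>Variables are independent when their joint law is the product of their laws. Restriction
  to the index set is the identity on the sample space, so the joint law is the product measure
  itself. Positivity of \<open>n\<close> and \<open>m\<close> keeps the index set nonempty.\<close>

lemma indep_coords:
  assumes "n > 0" "m > 0"
  shows "prob_space.indep_vars (sample_space D n m) (\<lambda>_. D) (\<lambda>p X. X p) ({1..n} \<times> {1..m})"
proof -
  interpret S: prob_space "sample_space D n m" by (rule prob_space_sample_space)
  let ?I = "{1..n} \<times> {1..m}"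
  have "distr (sample_space D n m) (\<Pi>\<^sub>M p\<in>?I. D) (\<lambda>X. \<lambda>p\<in>?I. X p)
      = distr (sample_space D n m) (sample_space D n m) (\<lambda>X. X)"
    unfolding sample_space_def by (intro distr_cong) (auto simp: space_PiM PiE_restrict)
  also have "\<dots> = (\<Pi>\<^sub>M p\<in>?I. distr (sample_space D n m) D (\<lambda>X. X p))"
    unfolding distr_id by (subst sample_space_def, rule PiM_cong) (auto simp: distr_coord)
  finally show ?thesis
    by (subst S.indep_vars_iff_distr_eq_PiM')
       (use assms in \<open>auto simp: sample_space_def\<close>)
qed

lemma rank_mem:
  assumes "is_profile n m \<sigma>" "i \<in> {1..n}" "j \<in> {1..m}"
  shows "\<sigma> i j \<in> {1..m}"
  using assms bij_betw_apply[of "\<sigma> i"] unfolding is_profile_def by blast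

lemma util_measurable [measurable]:
  assumes "is_profile n m \<sigma>" "i \<in> {1..n}" "j \<in> {1..m}"
  shows "(\<lambda>X. util m \<sigma> X i j) \<in> borel_measurable (sample_space D n m)"
  unfolding util_def
  by (rule borel_measurable_kth_largest[OF rank_mem[OF assms]]) (rule measurable_coord[OF assms(2)])

lemma util_unit:
  assumes "is_profile n m \<sigma>" "i \<in> {1..n}" "j \<in> {1..m}" "\<forall>p\<in>{1..n} \<times> {1..m}. X p \<in> {0..1}"
  shows "util m \<sigma> X i j \<in> {0..1}"
proof -
  obtain k where "k \<in> {1..m}" "util m \<sigma> X i j = X (i, k)"
    using kth_largest_mem[OF rank_mem[OF assms(1-3)], of "\<lambda>k. X (i, k)"] unfolding util_def by blast
  then show ?thesis using assms(2,4) by simp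
qed

lemma AE_util_unit:
  assumes "is_profile n m \<sigma>" "i \<in> {1..n}" "j \<in> {1..m}"
  shows "AE X in sample_space D n m. util m \<sigma> X i j \<in> {0..1}"
  using AE_coords_unit[of n m] by eventually_elim (rule util_unit[OF assms])

lemma integrable_util:
  assumes "is_profile n m \<sigma>" "i \<in> {1..n}" "j \<in> {1..m}"
  shows "integrable (sample_space D n m) (\<lambda>X. util m \<sigma> X i j)"
  by (rule prob_space.integrable_AE_unit[OF prob_space_sample_space util_measurable[OF assms] AE_util_unit[OF assms]])

lemma integrable_sw:
  assumes "is_profile n m \<sigma>" "j \<in> {1..m}"
  shows "integrable (sample_space D n m) (\<lambda>X. sw n m \<sigma> X j)"
  unfolding sw_def by (rule Bochner_Integration.integrable_sum) (rule integrable_util[OF assms(1) _ assms(2)])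

text \<open>Each ranking is a bijection, so one voter's utilities over all alternatives run through
  all order statistics of that voter's samples; by \<open>sum_kth_largest\<close> their sum is the
  sum of the samples.\<close>

lemma sum_exp_sw:
  assumes "is_profile n m \<sigma>"
  shows "(\<Sum>j\<in>{1..m}. exp_sw D n m \<sigma> j) = real n * real m * \<mu>"
proof -
  have "(\<Sum>j\<in>{1..m}. exp_sw D n m \<sigma> j) = (\<integral>X. (\<Sum>j\<in>{1..m}. sw n m \<sigma> X j) \<partial>sample_space D n m)"
    unfolding exp_sw_def using assms by (subst Bochner_Integration.integral_sum) (auto intro: integrable_sw)
  also have "(\<lambda>X. \<Sum>j\<in>{1..m}. sw n m \<sigma> X j) = (\<lambda>X. \<Sum>i\<in>{1..n}. \<Sum>k\<in>{1..m}. X (i, k))"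
  proof
    fix X
    have "(\<Sum>j\<in>{1..m}. sw n m \<sigma> X j) = (\<Sum>i\<in>{1..n}. \<Sum>j\<in>{1..m}. util m \<sigma> X i j)"
      unfolding sw_def by (rule sum.swap)
    also have "\<dots> = (\<Sum>i\<in>{1..n}. \<Sum>r\<in>{1..m}. kth_largest m (\<lambda>k. X (i, k)) r)"
      unfolding util_def using assms
      by (intro sum.cong refl sum.reindex_bij_betw) (auto simp: is_profile_def)
    finally show "(\<Sum>j\<in>{1..m}. sw n m \<sigma> X j) = (\<Sum>i\<in>{1..n}. \<Sum>k\<in>{1..m}. X (i, k))"
      by (simp only: sum_kth_largest)
  qed
  also have "(\<integral>X. (\<Sum>i\<in>{1..n}. \<Sum>k\<in>{1..m}. X (i, k)) \<partial>sample_space D n m)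
      = (\<Sum>i\<in>{1..n}. \<Sum>k\<in>{1..m}. \<integral>X. X (i, k) \<partial>sample_space D n m)"
  proof -
    have "integrable (sample_space D n m) (\<lambda>X. X (i, k))" if "i \<in> {1..n}" "k \<in> {1..m}" for i k
    proof (rule prob_space.integrable_AE_unit[OF prob_space_sample_space])
      show "AE X in sample_space D n m. X (i, k) \<in> {0..1}"
        using AE_coords_unit[of n m] by eventually_elim (use that in blast)
    qed (use that measurable_coord in auto)
    then show ?thesis
      by (subst Bochner_Integration.integral_sum)
         (auto intro!: Bochner_Integration.integrable_sum sum.cong Bochner_Integration.integral_sum)
  qed
  also have "\<dots> = (\<Sum>i\<in>{1..n}. \<Sum>k\<in>{1..m}. \<mu>)"
    by (intro sum.cong refl expectation_coord[where g = "\<lambda>x. x"]) auto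
  finally show ?thesis by simp
qed

lemma sw_bounds:
  assumes "is_profile n m \<sigma>" "j \<in> {1..m}" "\<forall>p\<in>{1..n} \<times> {1..m}. X p \<in> {0..1}"
  shows "0 \<le> sw n m \<sigma> X j" "sw n m \<sigma> X j \<le> real n"
proof -
  have u: "0 \<le> util m \<sigma> X i j \<and> util m \<sigma> X i j \<le> 1" if "i \<in> {1..n}" for i
    using util_unit[OF assms(1) that assms(2,3)] by simp
  show "0 \<le> sw n m \<sigma> X j" unfolding sw_def using u by (intro sum_nonneg) auto
  show "sw n m \<sigma> X j \<le> real n"
    unfolding sw_def using sum_bounded_above[of "{1..n}" "\<lambda>i. util m \<sigma> X i j" 1] u by simp
qed

lemma distortion_unit:
  assumes "is_profile n m \<sigma>" "j \<in> {1..m}" "\<forall>p\<in>{1..n} \<times> {1..m}. X p \<in> {0..1}"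
  shows "distortion n m \<sigma> j X \<in> {0..1}"
proof -
  have "0 \<le> sw n m \<sigma> X j" by (rule sw_bounds[OF assms])
  moreover have "sw n m \<sigma> X j \<le> Max ((\<lambda>k. sw n m \<sigma> X k) ` {1..m})"
    using assms(2) by (intro Max_ge) auto
  \<comment> \<open>If the maximal welfare is 0, division by zero makes the distortion 0, which is
    still in the interval.\<close>
  ultimately show ?thesis unfolding distortion_def by (auto simp: divide_le_eq_1)
qed

lemma integrable_distortion:
  assumes "is_profile n m \<sigma>" "j \<in> {1..m}"
  shows "integrable (sample_space D n m) (distortion n m \<sigma> j)"
proof (rule prob_space.integrable_AE_unit[OF prob_space_sample_space])
  have [measurable]: "(\<lambda>X. sw n m \<sigma> X k) \<in> borel_measurable (sample_space D n m)" if "k \<in> {1..m}" for k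
    using integrable_sw[OF assms(1) that] by simp
  have [measurable]: "(\<lambda>X. Max ((\<lambda>k. sw n m \<sigma> X k) ` {1..m})) \<in> borel_measurable (sample_space D n m)"
    by (rule borel_measurable_Max) auto
  show "distortion n m \<sigma> j \<in> borel_measurable (sample_space D n m)"
    unfolding distortion_def using assms(2) by measurable
  show "AE X in sample_space D n m. distortion n m \<sigma> j X \<in> {0..1}"
    using AE_coords_unit[of n m] by eventually_elim (rule distortion_unit[OF assms])
qed

section \<open>From welfare deviations to expected distortion\<close>

text \<open>A maximum is at least the average, and by \<open>sum_exp_sw\<close> the average expected
  welfare of the \<open>m\<close> alternatives is \<open>real n * \<mu>\<close>.\<close>

lemma exp_sw_ewm_ge:
  assumes "is_profile n m \<sigma>" "ewm_rule D n m f"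
  shows "real n * \<mu> \<le> exp_sw D n m \<sigma> (f \<sigma>)"
proof -
  have f: "f \<sigma> \<in> {1..m}" and le: "\<And>k. k \<in> {1..m} \<Longrightarrow> exp_sw D n m \<sigma> k \<le> exp_sw D n m \<sigma> (f \<sigma>)"
    using assms unfolding ewm_rule_def by blast+
  have "real m * (real n * \<mu>) = (\<Sum>j\<in>{1..m}. exp_sw D n m \<sigma> j)"
    using sum_exp_sw[OF assms(1)] by simp
  also have "\<dots> \<le> real m * exp_sw D n m \<sigma> (f \<sigma>)"
    using sum_bounded_above[of "{1..m}" "exp_sw D n m \<sigma>"] le by simp
  finally show ?thesis using f by simp
qed

lemma mean_nonneg: "0 \<le> \<mu>"
  using AE_unit by (intro integral_nonneg_AE) (auto elim: eventually_mono)

text \<open>This settles the degenerate case of no voters or zero mean, where one cannot divide by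
  \<open>real n * \<mu>\<close>. Nonnegative expected welfares with sum 0 all vanish, so the welfare
  of \<open>j\<close> is 0 almost surely.\<close>

lemma exp_dist_eq_0:
  assumes "is_profile n m \<sigma>" "j \<in> {1..m}" "real n * \<mu> = 0"
  shows "exp_dist D n m \<sigma> j = 0"
proof -
  interpret S: prob_space "sample_space D n m" by (rule prob_space_sample_space)
  have nn: "AE X in sample_space D n m. 0 \<le> sw n m \<sigma> X k" if "k \<in> {1..m}" for k
    using AE_coords_unit[of n m] by eventually_elim (rule sw_bounds[OF assms(1) that])
  have "exp_sw D n m \<sigma> k \<ge> 0" if "k \<in> {1..m}" for k
    unfolding exp_sw_def using nn[OF that] by (rule integral_nonneg_AE)
  moreover have "(\<Sum>k\<in>{1..m}. exp_sw D n m \<sigma> k) = 0"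
    using sum_exp_sw[OF assms(1)] assms(3) by auto
  ultimately have "exp_sw D n m \<sigma> j = 0"
    using assms(2) by (subst (asm) sum_nonneg_eq_0_iff) auto
  then have "AE X in sample_space D n m. sw n m \<sigma> X j = 0"
    unfolding exp_sw_def using integral_nonneg_eq_0_iff_AE[OF integrable_sw[OF assms(1,2)] nn[OF assms(2)]] by simp
  then have "AE X in sample_space D n m. distortion n m \<sigma> j X = 0"
    by eventually_elim (simp add: distortion_def)
  then show ?thesis unfolding exp_dist_def by (rule integral_eq_zero_AE)
qed

text \<open>This is the pointwise comparison behind the whole proof, used with \<open>a\<close> and
  \<open>b\<close> the expected welfares of \<open>j\<close> and \<open>w\<close>, and
  \<open>c = real n * \<mu>\<close>.\<close>

lemma distortion_diff_le:
  assumes prof: "is_profile n m \<sigma>" and j: "j \<in> {1..m}" and w: "w \<in> {1..m}"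
    and X: "\<forall>p\<in>{1..n} \<times> {1..m}. X p \<in> {0..1}"
    and c: "0 < c" "c \<le> b" and "a \<le> b"
  shows "distortion n m \<sigma> j X - distortion n m \<sigma> w X
    \<le> 2 / c * (\<bar>sw n m \<sigma> X j - a\<bar> + \<bar>sw n m \<sigma> X w - b\<bar>)"
proof -
  define T where "T = Max ((\<lambda>k. sw n m \<sigma> X k) ` {1..m})"
  define E where "E = \<bar>sw n m \<sigma> X j - a\<bar> + \<bar>sw n m \<sigma> X w - b\<bar>"
  have "sw n m \<sigma> X w \<le> T" unfolding T_def using w by (intro Max_ge) auto
  show ?thesis
  proof (cases "T < c / 2")
    case True
    \<comment> \<open>The welfare of \<open>w\<close> is below \<open>c / 2\<close> while
      \<open>b \<ge> c\<close>, so its deviation alone exceeds \<open>c / 2\<close>. The claimed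
      bound is then at least 1, and two distortions never differ by more than 1.\<close>
    then have "c / 2 \<le> E" using \<open>sw n m \<sigma> X w \<le> T\<close> c unfolding E_def by linarith
    then have "1 \<le> 2 / c * E" using c by (simp add: field_simps)
    then show ?thesis
      using distortion_unit[OF prof j X] distortion_unit[OF prof w X] by (simp add: E_def)
  next
    case False
    have "distortion n m \<sigma> j X - distortion n m \<sigma> w X = (sw n m \<sigma> X j - sw n m \<sigma> X w) / T"
      by (simp add: distortion_def T_def diff_divide_distrib)
    \<comment> \<open>The numerator is at most \<open>E + (a - b)\<close>, and
      \<open>a \<le> b\<close>.\<close>
    also have "\<dots> \<le> E / T"
      using False c \<open>a \<le> b\<close> unfolding E_def by (intro divide_right_mono) linarith+
    also have "\<dots> \<le> E / (c / 2)"
      using False c unfolding E_def by (intro divide_left_mono) auto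
    also have "\<dots> = 2 / c * E" by simp
    finally show ?thesis by (simp only: E_def)
  qed
qed

text \<open>Both parts of the theorem reduce to this bound on mean absolute deviations. One factor
  \<open>\<mu>\<close> in \<open>\<epsilon> * \<mu>\<^sup>2 / 4\<close> cancels against
  \<open>2 / (real n * \<mu>)\<close>, leaving an additive loss \<open>\<epsilon> * \<mu>\<close>;
  the other turns it into a relative loss, because the chosen alternative has expected distortion at
  least \<open>\<mu>\<close>. The premise \<open>0 < real n * \<mu>\<close> of the deviation bound
  leaves the degenerate case to \<open>exp_dist_eq_0\<close>.\<close>

lemma exp_dist_ewm_ge:
  assumes prof: "is_profile n m \<sigma>" and ewm: "ewm_rule D n m f" and "\<epsilon> > 0"
    and dev: "\<And>j. 0 < real n * \<mu> \<Longrightarrow> j \<in> {1..m} \<Longrightarrow>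
      (\<integral>X. \<bar>sw n m \<sigma> X j - exp_sw D n m \<sigma> j\<bar> \<partial>sample_space D n m) \<le> real n * (\<epsilon> * \<mu>\<^sup>2 / 4)"
  shows "(1 - \<epsilon>) * Max ((\<lambda>j. exp_dist D n m \<sigma> j) ` {1..m}) \<le> exp_dist D n m \<sigma> (f \<sigma>)"
proof -
  interpret S: prob_space "sample_space D n m" by (rule prob_space_sample_space)
  define w where "w = f \<sigma>"
  have w: "w \<in> {1..m}" and le: "\<And>k. k \<in> {1..m} \<Longrightarrow> exp_sw D n m \<sigma> k \<le> exp_sw D n m \<sigma> w"
    using prof ewm unfolding ewm_rule_def w_def by blast+
  \<comment> \<open>The chosen \<open>w\<close> witnesses that there is an alternative, so the
    maximum is over a nonempty set and is attained.\<close>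
  have "Max ((\<lambda>j. exp_dist D n m \<sigma> j) ` {1..m}) \<in> (\<lambda>j. exp_dist D n m \<sigma> j) ` {1..m}"
    using w by (intro Max_in) auto
  then obtain j where j: "j \<in> {1..m}"
    and Max_eq: "Max ((\<lambda>j. exp_dist D n m \<sigma> j) ` {1..m}) = exp_dist D n m \<sigma> j"
    by blast
  have "exp_dist D n m \<sigma> w \<le> exp_dist D n m \<sigma> j"
    unfolding Max_eq[symmetric] using w by (intro Max_ge) auto
  show ?thesis
  proof (cases "real n * \<mu> = 0")
    case True
    show ?thesis unfolding Max_eq w_def[symmetric]
      unfolding exp_dist_eq_0[OF prof j True] exp_dist_eq_0[OF prof w True] by simp
  next
    case False
    then have "0 < real n" by (cases n) auto
    moreover have "0 < \<mu>" using False mean_nonneg by (metis mult_zero_right order_le_less)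
    ultimately have pos: "0 < real n" "0 < \<mu>" "0 < real n * \<mu>" by simp_all
    have ge: "real n * \<mu> \<le> exp_sw D n m \<sigma> w"
      unfolding w_def by (rule exp_sw_ewm_ge[OF prof ewm])
    have int_dev: "integrable (sample_space D n m) (\<lambda>X. \<bar>sw n m \<sigma> X k - exp_sw D n m \<sigma> k\<bar>)" if "k \<in> {1..m}" for k
      using integrable_sw[OF prof that] by simp
    have "exp_dist D n m \<sigma> j - exp_dist D n m \<sigma> w
        = (\<integral>X. distortion n m \<sigma> j X - distortion n m \<sigma> w X \<partial>sample_space D n m)"
      unfolding exp_dist_def
      by (intro Bochner_Integration.integral_diff[symmetric] integrable_distortion prof j w)
    also have "\<dots> \<le> (\<integral>X. 2 / (real n * \<mu>) * (\<bar>sw n m \<sigma> X j - exp_sw D n m \<sigma> j\<bar>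
        + \<bar>sw n m \<sigma> X w - exp_sw D n m \<sigma> w\<bar>) \<partial>sample_space D n m)"
    proof (rule integral_mono_AE)
      show "AE X in sample_space D n m. distortion n m \<sigma> j X - distortion n m \<sigma> w X
        \<le> 2 / (real n * \<mu>) * (\<bar>sw n m \<sigma> X j - exp_sw D n m \<sigma> j\<bar> + \<bar>sw n m \<sigma> X w - exp_sw D n m \<sigma> w\<bar>)"
        using AE_coords_unit[of n m]
        by eventually_elim (rule distortion_diff_le[OF prof j w _ pos(3) ge le[OF j]])
    qed (intro Bochner_Integration.integrable_diff Bochner_Integration.integrable_add
           Bochner_Integration.integrable_mult_right integrable_distortion prof j w int_dev)+
    also have "\<dots> = 2 / (real n * \<mu>) * ((\<integral>X. \<bar>sw n m \<sigma> X j - exp_sw D n m \<sigma> j\<bar> \<partial>sample_space D n m)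
        + (\<integral>X. \<bar>sw n m \<sigma> X w - exp_sw D n m \<sigma> w\<bar> \<partial>sample_space D n m))"
      using int_dev j w by (simp add: Bochner_Integration.integral_add)
    also have "\<dots> \<le> 2 / (real n * \<mu>) * (real n * (\<epsilon> * \<mu>\<^sup>2 / 4) + real n * (\<epsilon> * \<mu>\<^sup>2 / 4))"
      using pos j w by (intro mult_left_mono add_mono dev pos(3)) auto
    also have "\<dots> = \<epsilon> * \<mu>"
      using pos by (simp add: field_simps power2_eq_square)
    finally have diff: "exp_dist D n m \<sigma> j - exp_dist D n m \<sigma> w \<le> \<epsilon> * \<mu>" .
    \<comment> \<open>No welfare exceeds \<open>n\<close>, so dividing by the maximal welfare loses
      at most a factor \<open>n\<close>. If that maximum is 0, the welfare of \<open>w\<close> is 0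
      as well.\<close>
    have "real n * \<mu> \<le> (\<integral>X. real n * distortion n m \<sigma> w X \<partial>sample_space D n m)"
    proof (rule order_trans[OF ge], unfold exp_sw_def, rule integral_mono_AE)
      show "AE X in sample_space D n m. sw n m \<sigma> X w \<le> real n * distortion n m \<sigma> w X"
        using AE_coords_unit[of n m]
      proof eventually_elim
        case (elim X)
        let ?T = "Max ((\<lambda>k. sw n m \<sigma> X k) ` {1..m})"
        have "sw n m \<sigma> X w \<le> ?T" using w by (intro Max_ge) auto
        moreover have "0 \<le> sw n m \<sigma> X w" by (rule sw_bounds[OF prof w elim])
        moreover have "?T \<le> real n" using sw_bounds(2)[OF prof _ elim] w by (subst Max_le_iff) auto
        ultimately have "sw n m \<sigma> X w * ?T \<le> sw n m \<sigma> X w * real n" "0 \<le> ?T"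
          by (auto intro: mult_left_mono)
        then show ?case
          using \<open>sw n m \<sigma> X w \<le> ?T\<close> \<open>0 \<le> sw n m \<sigma> X w\<close> unfolding distortion_def
          by (cases "?T = 0") (simp_all add: le_divide_eq mult.commute)
      qed
    qed (intro integrable_sw integrable_distortion Bochner_Integration.integrable_mult_right prof w)+
    then have "\<mu> \<le> exp_dist D n m \<sigma> w"
      using pos by (simp add: exp_dist_def)
    then have "\<epsilon> * \<mu> \<le> \<epsilon> * exp_dist D n m \<sigma> j"
      using \<open>\<epsilon> > 0\<close> \<open>exp_dist D n m \<sigma> w \<le> exp_dist D n m \<sigma> j\<close> by simp
    then show ?thesis
      using diff unfolding Max_eq w_def[symmetric] by (simp add: algebra_simps)
  qed
qed

section \<open>Many voters: concentration across independent voters\<close>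

text \<open>The utility of voter \<open>i\<close> is a measurable function of the coordinates in the
  block \<open>{i} \<times> {1..m}\<close>, and blocks of different voters are disjoint.\<close>

lemma indep_utils:
  assumes "is_profile n m \<sigma>" "j \<in> {1..m}" "n > 0"
  shows "prob_space.indep_vars (sample_space D n m) (\<lambda>_. borel) (\<lambda>i X. util m \<sigma> X i j) {1..n}"
proof -
  interpret S: prob_space "sample_space D n m" by (rule prob_space_sample_space)
  have "m > 0" using assms(2) by simp
  have "S.indep_vars (\<lambda>i. \<Pi>\<^sub>M p\<in>{i} \<times> {1..m}. D) (\<lambda>i X. restrict (\<lambda>p. X p) ({i} \<times> {1..m})) {1..n}"
    by (rule S.indep_vars_restrict[OF indep_coords[OF \<open>n > 0\<close> \<open>m > 0\<close>]])
       (auto simp: disjoint_family_on_def)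
  then have "S.indep_vars (\<lambda>_. borel)
      (\<lambda>i X. kth_largest m (\<lambda>k. restrict (\<lambda>p. X p) ({i} \<times> {1..m}) (i, k)) (\<sigma> i j)) {1..n}"
  proof (rule S.indep_vars_compose2[where Y = "\<lambda>i Z. kth_largest m (\<lambda>k. Z (i, k)) (\<sigma> i j)"])
    fix i assume i: "i \<in> {1..n}"
    show "(\<lambda>Z. kth_largest m (\<lambda>k. Z (i, k)) (\<sigma> i j)) \<in> borel_measurable (\<Pi>\<^sub>M p\<in>{i} \<times> {1..m}. D)"
    proof (rule borel_measurable_kth_largest[OF rank_mem[OF assms(1) i assms(2)]])
      fix k assume "k \<in> {1..m}"
      then show "(\<lambda>Z. Z (i, k)) \<in> borel_measurable (\<Pi>\<^sub>M p\<in>{i} \<times> {1..m}. D)"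
        by (intro measurable_compose[OF measurable_component_singleton[of "(i, k)"]])
           (auto simp: measurable_ident_sets sets_D)
    qed
  qed
  moreover have "kth_largest m (\<lambda>k. restrict (\<lambda>p. X p) ({i} \<times> {1..m}) (i, k)) (\<sigma> i j) = util m \<sigma> X i j" for i X
    unfolding util_def kth_largest_def
    by (intro arg_cong2[where f = nth] arg_cong[where f = rev] arg_cong[where f = sort] map_cong) auto
  ultimately show ?thesis by (simp only:)
qed

lemma sw_deviation_many_voters:
  assumes "is_profile n m \<sigma>" "j \<in> {1..m}" "n > 0" "\<eta> \<ge> 0"
  shows "(\<integral>X. \<bar>sw n m \<sigma> X j - exp_sw D n m \<sigma> j\<bar> \<partial>sample_space D n m)
    \<le> real n * (\<eta> + 2 * exp (- 2 * real n * \<eta>\<^sup>2))"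
proof -
  interpret S: prob_space "sample_space D n m" by (rule prob_space_sample_space)
  have "{1..n} \<noteq> {}" using \<open>n > 0\<close> by simp
  from S.expectation_abs_sum_deviation_le[OF finite_atLeastAtMost this indep_utils[OF assms(1-3)] _ assms(4)]
    AE_util_unit[OF assms(1) _ assms(2)]
  show ?thesis unfolding sw_def exp_sw_def by simp
qed

lemma exp_tail_le:
  fixes \<delta> :: real
  assumes "\<delta> > 0" "\<eta> > 0"
  shows "\<exists>N0. \<forall>N\<ge>N0. 0 < N \<and> c * exp (- 2 * real N * \<eta>\<^sup>2) \<le> \<delta>"
proof -
  have "(\<lambda>N. c * exp (- 2 * real N * \<eta>\<^sup>2)) \<longlonglongrightarrow> 0"
    using \<open>\<eta> > 0\<close> by real_asymp
  then have "eventually (\<lambda>N. c * exp (- 2 * real N * \<eta>\<^sup>2) < \<delta>) sequentially"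
    using \<open>\<delta> > 0\<close> by (rule order_tendstoD)
  then have "eventually (\<lambda>N. 0 < N \<and> c * exp (- 2 * real N * \<eta>\<^sup>2) \<le> \<delta>) sequentially"
    using eventually_gt_at_top[of 0] by eventually_elim auto
  then show ?thesis by (simp add: eventually_sequentially)
qed

lemma ewm_many_voters:
  assumes "\<epsilon> > 0"
  shows "\<exists>n0. \<forall>n\<ge>n0. \<forall>m \<sigma> f. is_profile n m \<sigma> \<longrightarrow> ewm_rule D n m f \<longrightarrow>
    (1 - \<epsilon>) * Max ((\<lambda>j. exp_dist D n m \<sigma> j) ` {1..m}) \<le> exp_dist D n m \<sigma> (f \<sigma>)"
proof -
  \<comment> \<open>\<open>\<delta>\<close> is the deviation per voter allowed by
    \<open>exp_dist_ewm_ge\<close>; half goes to the Hoeffding threshold and half to the tail. For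
    zero mean \<open>\<delta>\<close> is 0, so the property of \<open>n0\<close> is conditional on
    \<open>\<delta> > 0\<close>.\<close>
  define \<delta> where "\<delta> = \<epsilon> * \<mu>\<^sup>2 / 4"
  obtain n0 where n0: "0 < n \<and> 2 * exp (- 2 * real n * (\<delta> / 2)\<^sup>2) \<le> \<delta> / 2" if "\<delta> > 0" "n \<ge> n0" for n
    using exp_tail_le[of "\<delta> / 2" "\<delta> / 2" 2] by (cases "\<delta> > 0") auto
  have "(1 - \<epsilon>) * Max ((\<lambda>j. exp_dist D n m \<sigma> j) ` {1..m}) \<le> exp_dist D n m \<sigma> (f \<sigma>)"
    if "n \<ge> n0" "is_profile n m \<sigma>" "ewm_rule D n m f" for n m \<sigma> f
  proof (rule exp_dist_ewm_ge[OF that(2,3) \<open>\<epsilon> > 0\<close>])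
    fix j assume "0 < real n * \<mu>" and j: "j \<in> {1..m}"
    then have "\<delta> > 0" using \<open>\<epsilon> > 0\<close> by (auto simp: \<delta>_def zero_less_mult_iff)
    note bound = n0[OF this \<open>n \<ge> n0\<close>]
    have "(\<integral>X. \<bar>sw n m \<sigma> X j - exp_sw D n m \<sigma> j\<bar> \<partial>sample_space D n m)
        \<le> real n * (\<delta> / 2 + 2 * exp (- 2 * real n * (\<delta> / 2)\<^sup>2))"
      using bound \<open>\<delta> > 0\<close> by (intro sw_deviation_many_voters that j) auto
    also have "\<dots> \<le> real n * \<delta>"
      using bound by (intro mult_left_mono) auto
    finally show "(\<integral>X. \<bar>sw n m \<sigma> X j - exp_sw D n m \<sigma> j\<bar> \<partial>sample_space D n m) \<le> real n * (\<epsilon> * \<mu>\<^sup>2 / 4)"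
      by (simp add: \<delta>_def)
  qed
  then show ?thesis by blast
qed

section \<open>Many alternatives: each utility is near a quantile\<close>

text \<open>For a single voter, the number of samples above \<open>t\<close> is a sum of
  \<open>m\<close> independent indicators, each of mean \<open>1 - cdf D t\<close>.\<close>

lemma prob_count_deviation_le:
  assumes i: "i \<in> {1..n}" and "m > 0" and "\<eta> \<ge> 0"
  shows "measure (sample_space D n m) {X\<in>space (sample_space D n m).
      real m * \<eta> \<le> \<bar>real (card {k\<in>{1..m}. t < X (i, k)}) - real m * (1 - cdf D t)\<bar>}
    \<le> 2 * exp (- 2 * real m * \<eta>\<^sup>2)"
proof -
  interpret S: prob_space "sample_space D n m" by (rule prob_space_sample_space)
  have "n > 0" using i by simp
  let ?I = "{i} \<times> {1..m}"
  have "S.indep_vars (\<lambda>_. D) (\<lambda>p X. X p) ?I"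
    by (rule S.indep_vars_subset[OF indep_coords[OF \<open>n > 0\<close> \<open>m > 0\<close>]]) (use i in auto)
  then have ind: "S.indep_vars (\<lambda>_. borel) (\<lambda>p X. indicat_real {t<..} (X p)) ?I"
    by (rule S.indep_vars_compose2) (simp add: measurable_cong_sets[OF sets_D refl])
  have cnt: "(\<Sum>p\<in>?I. indicat_real {t<..} (X p)) = real (card {k\<in>{1..m}. t < X (i, k)})" for X
    by (subst card_gt_eq_sum_indicator)
       (auto intro!: sum.reindex_bij_witness[of _ "Pair i" snd])
  have "(\<integral>X. indicat_real {t<..} (X p) \<partial>sample_space D n m) = 1 - cdf D t" if "p \<in> ?I" for p
  proof -
    obtain k where k: "p = (i, k)" "k \<in> {1..m}" using \<open>p \<in> ?I\<close> by auto
    have "(\<integral>X. indicat_real {t<..} (X p) \<partial>sample_space D n m) = (\<integral>x. indicat_real {t<..} x \<partial>D)"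
      unfolding k(1) by (rule expectation_coord[OF i k(2)]) simp
    also have "\<dots> = prob (space D - {..t})"
      using sets_eq_imp_space_eq[OF sets_D] by (auto simp: sets_D intro!: arg_cong[where f = prob])
    also have "\<dots> = 1 - cdf D t"
      unfolding cdf_def by (rule prob_compl) (simp add: sets_D)
    finally show ?thesis .
  qed
  then have mean: "(\<Sum>p\<in>?I. \<integral>X. indicat_real {t<..} (X p) \<partial>sample_space D n m) = real m * (1 - cdf D t)"
    by (simp add: card_cartesian_product)
  have "card ?I = m" "?I \<noteq> {}" using \<open>m > 0\<close> by (auto simp: card_cartesian_product)
  then show ?thesis
    using S.prob_sum_deviation_le[OF _ _ ind _ \<open>\<eta> \<ge> 0\<close>]
    unfolding cnt mean by (simp add: indicator_def)
qed

text \<open>A deterministic statement: were the order statistic above \<open>q + \<delta>\<close>,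
  at least \<open>r\<close> samples would exceed that threshold, although the predicted count there
  is at most \<open>r - m * \<eta>\<close>. Below \<open>q - \<delta>\<close> the argument is
  symmetric.\<close>

lemma order_statistic_near_quantile:
  assumes r: "r \<in> {1..m}" and x: "\<And>k. k \<in> {1..m} \<Longrightarrow> x k \<in> {0..1}"
    and q: "cdf D q = 1 - real r / real m" "q \<in> {0..1}"
    and gap: "\<And>y. 0 \<le> y \<Longrightarrow> y + \<delta> \<le> 1 \<Longrightarrow> cdf D y + \<eta> \<le> cdf D (y + \<delta>)"
    and close: "\<And>t. t \<in> {q + \<delta>, q - \<delta>} \<Longrightarrow>
      \<bar>real (card {k\<in>{1..m}. t < x k}) - real m * (1 - cdf D t)\<bar> < real m * \<eta>"
  shows "\<bar>kth_largest m x r - q\<bar> \<le> \<delta>"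
proof -
  define y where "y = kth_largest m x r"
  have y: "y \<in> {0..1}" using kth_largest_mem[OF r, of x] x unfolding y_def by auto
  have rq: "real m * (1 - cdf D q) = real r" using r q by simp
  have "y \<le> q + \<delta>"
  proof (rule ccontr)
    assume *: "\<not> y \<le> q + \<delta>"
    then have "real r \<le> real (card {k\<in>{1..m}. q + \<delta> < x k})"
      using kth_largest_gt_iff[OF r, of "q + \<delta>" x] by (simp add: y_def)
    \<comment> \<open>The order statistic lies in the unit interval and exceeds
      \<open>q + \<delta>\<close>, so \<open>q + \<delta> \<le> 1\<close> and \<open>gap\<close>
      applies.\<close>
    moreover have "cdf D q + \<eta> \<le> cdf D (q + \<delta>)" using gap * y q(2) by simp
    then have "real m * (1 - cdf D (q + \<delta>)) \<le> real m * (1 - cdf D q - \<eta>)"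
      by (intro mult_left_mono) auto
    ultimately show False using close[of "q + \<delta>"] rq by (simp add: algebra_simps)
  qed
  moreover have "q - \<delta> \<le> y"
  proof (rule ccontr)
    assume *: "\<not> q - \<delta> \<le> y"
    then have "real (card {k\<in>{1..m}. q - \<delta> < x k}) < real r"
      using kth_largest_gt_iff[OF r, of "q - \<delta>" x] by (simp add: y_def)
    moreover have "cdf D (q - \<delta>) + \<eta> \<le> cdf D q" using gap[of "q - \<delta>"] * y q(2) by simp
    then have "real m * (1 - cdf D q + \<eta>) \<le> real m * (1 - cdf D (q - \<delta>))"
      by (intro mult_left_mono) auto
    ultimately show False using close[of "q - \<delta>"] rq by (simp add: algebra_simps)
  qed
  ultimately show ?thesis unfolding y_def by auto
qed

text \<open>Outside two bad events, a badly deviating count at \<open>q + \<delta>\<close> or at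
  \<open>q - \<delta>\<close>, the error is at most \<open>\<delta>\<close>; on them it is at most
  1. Each has probability at most \<open>2 * exp (- 2 * real m * \<eta>\<^sup>2)\<close>, whence the
  factor 4.\<close>

lemma util_deviation_quantile:
  assumes prof: "is_profile n m \<sigma>" and i: "i \<in> {1..n}" and j: "j \<in> {1..m}"
    and q: "cdf D q = 1 - real (\<sigma> i j) / real m" "q \<in> {0..1}"
    and gap: "\<And>y. 0 \<le> y \<Longrightarrow> y + \<delta> \<le> 1 \<Longrightarrow> cdf D y + \<eta> \<le> cdf D (y + \<delta>)"
    and "\<delta> \<ge> 0" "\<eta> \<ge> 0"
  shows "(\<integral>X. \<bar>util m \<sigma> X i j - q\<bar> \<partial>sample_space D n m) \<le> \<delta> + 4 * exp (- 2 * real m * \<eta>\<^sup>2)"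
proof -
  interpret S: prob_space "sample_space D n m" by (rule prob_space_sample_space)
  have "m > 0" using j by simp
  define B where "B t = {X\<in>space (sample_space D n m).
      real m * \<eta> \<le> \<bar>real (card {k\<in>{1..m}. t < X (i, k)}) - real m * (1 - cdf D t)\<bar>}" for t
  have [measurable]: "B t \<in> sets (sample_space D n m)" for t
  proof -
    have [measurable]: "(\<lambda>X. \<Sum>k\<in>{1..m}. indicat_real {t<..} (X (i, k))) \<in> borel_measurable (sample_space D n m)"
      using measurable_coord[OF i] by (intro borel_measurable_sum) simp
    show ?thesis unfolding B_def card_gt_eq_sum_indicator[OF finite_atLeastAtMost] by measurable
  qed
  have int_B: "integrable (sample_space D n m) (indicat_real (B t))" for t
    by (rule integrable_real_indicator) (auto simp: less_top[symmetric])
  have "(\<integral>X. \<bar>util m \<sigma> X i j - q\<bar> \<partial>sample_space D n m)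
      \<le> (\<integral>X. \<delta> + indicator (B (q + \<delta>)) X + indicator (B (q - \<delta>)) X \<partial>sample_space D n m)"
  proof (rule integral_mono_AE)
    show "AE X in sample_space D n m. \<bar>util m \<sigma> X i j - q\<bar>
        \<le> \<delta> + indicator (B (q + \<delta>)) X + indicator (B (q - \<delta>)) X"
      using AE_coords_unit[of n m] AE_space
    proof eventually_elim
      case (elim X)
      have u: "util m \<sigma> X i j \<in> {0..1}" by (rule util_unit[OF prof i j elim(1)])
      show ?case
      proof (cases "X \<in> B (q + \<delta>) \<union> B (q - \<delta>)")
        case True
        have "\<bar>util m \<sigma> X i j - q\<bar> \<le> 1" using u q(2) by auto
        also have "1 \<le> indicat_real (B (q + \<delta>)) X + indicat_real (B (q - \<delta>)) X"
          using True by (auto simp: indicator_def)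
        finally show ?thesis using \<open>\<delta> \<ge> 0\<close> by simp
      next
        case False
        have "\<bar>util m \<sigma> X i j - q\<bar> \<le> \<delta>" unfolding util_def
          by (rule order_statistic_near_quantile[OF rank_mem[OF prof i j] _ q gap])
             (use elim i False in \<open>auto simp: B_def not_le\<close>)
        then show ?thesis by (simp add: add_increasing2)
      qed
    qed
    show "integrable (sample_space D n m) (\<lambda>X. \<bar>util m \<sigma> X i j - q\<bar>)"
      using integrable_util[OF prof i j] by simp
    show "integrable (sample_space D n m) (\<lambda>X. \<delta> + indicator (B (q + \<delta>)) X + indicator (B (q - \<delta>)) X)"
      using int_B by (intro Bochner_Integration.integrable_add) auto
  qed
  also have "\<dots> = \<delta> + S.prob (B (q + \<delta>)) + S.prob (B (q - \<delta>))"
    using int_B by (simp add: Bochner_Integration.integral_add S.prob_space)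
  also have "\<dots> \<le> \<delta> + 2 * exp (- 2 * real m * \<eta>\<^sup>2) + 2 * exp (- 2 * real m * \<eta>\<^sup>2)"
    unfolding B_def by (intro add_mono order_refl prob_count_deviation_le i \<open>m > 0\<close> \<open>\<eta> \<ge> 0\<close>)
  finally show ?thesis by simp
qed

text \<open>No cancellation between voters is used: each utility is already close to its mean, and
  the errors are added up. Hence the deviation per voter is bounded uniformly in
  \<open>n\<close>.\<close>

lemma sw_deviation_many_alternatives:
  assumes prof: "is_profile n m \<sigma>" and j: "j \<in> {1..m}"
    and gap: "\<And>y. 0 \<le> y \<Longrightarrow> y + \<delta> \<le> 1 \<Longrightarrow> cdf D y + \<eta> \<le> cdf D (y + \<delta>)"
    and "\<delta> \<ge> 0" "\<eta> \<ge> 0"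
    and quantile: "\<And>v. v \<in> {0..1} \<Longrightarrow> \<exists>q\<in>{0..1}. cdf D q = v"
  shows "(\<integral>X. \<bar>sw n m \<sigma> X j - exp_sw D n m \<sigma> j\<bar> \<partial>sample_space D n m)
    \<le> real n * (2 * (\<delta> + 4 * exp (- 2 * real m * \<eta>\<^sup>2)))"
proof -
  interpret S: prob_space "sample_space D n m" by (rule prob_space_sample_space)
  define b where "b = \<delta> + 4 * exp (- 2 * real m * \<eta>\<^sup>2)"
  let ?U = "\<lambda>i X. util m \<sigma> X i j"
  have int: "integrable (sample_space D n m) (?U i)" if "i \<in> {1..n}" for i
    by (rule integrable_util[OF prof that j])
  have dev: "S.expectation (\<lambda>X. \<bar>?U i X - S.expectation (?U i)\<bar>) \<le> 2 * b" if i: "i \<in> {1..n}" for i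
  proof -
    have "1 - real (\<sigma> i j) / real m \<in> {0..1}" using rank_mem[OF prof i j] by auto
    then obtain q where q: "cdf D q = 1 - real (\<sigma> i j) / real m" "q \<in> {0..1}"
      using quantile by blast
    have le_b: "S.expectation (\<lambda>X. \<bar>?U i X - q\<bar>) \<le> b"
      unfolding b_def by (rule util_deviation_quantile[OF prof i j q gap \<open>\<delta> \<ge> 0\<close> \<open>\<eta> \<ge> 0\<close>])
    \<comment> \<open>Centering at the mean instead of the quantile costs a factor 2, as the mean
      itself is within \<open>b\<close> of \<open>q\<close>.\<close>
    have "\<bar>S.expectation (?U i) - q\<bar> = \<bar>S.expectation (\<lambda>X. ?U i X - q)\<bar>"
      using int[OF i] by (simp add: S.prob_space)
    also have "\<dots> \<le> S.expectation (\<lambda>X. \<bar>?U i X - q\<bar>)"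
      by (rule integral_abs_bound)
    finally have E: "\<bar>S.expectation (?U i) - q\<bar> \<le> b" using le_b by simp
    have "S.expectation (\<lambda>X. \<bar>?U i X - S.expectation (?U i)\<bar>) \<le> S.expectation (\<lambda>X. \<bar>?U i X - q\<bar> + b)"
      using int[OF i] E by (intro integral_mono) auto
    also have "\<dots> \<le> 2 * b" using int[OF i] le_b by (simp add: S.prob_space)
    finally show ?thesis .
  qed
  have "S.expectation (\<lambda>X. \<bar>sw n m \<sigma> X j - exp_sw D n m \<sigma> j\<bar>)
      \<le> S.expectation (\<lambda>X. \<Sum>i\<in>{1..n}. \<bar>?U i X - S.expectation (?U i)\<bar>)"
  proof (rule integral_mono)
    fix X
    have "sw n m \<sigma> X j - exp_sw D n m \<sigma> j = (\<Sum>i\<in>{1..n}. ?U i X - S.expectation (?U i))"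
      unfolding sw_def exp_sw_def using int
      by (simp add: Bochner_Integration.integral_sum sum_subtractf)
    then show "\<bar>sw n m \<sigma> X j - exp_sw D n m \<sigma> j\<bar> \<le> (\<Sum>i\<in>{1..n}. \<bar>?U i X - S.expectation (?U i)\<bar>)"
      by simp
  next
    show "integrable (sample_space D n m) (\<lambda>X. \<bar>sw n m \<sigma> X j - exp_sw D n m \<sigma> j\<bar>)"
      using integrable_sw[OF prof j] by simp
    show "integrable (sample_space D n m) (\<lambda>X. \<Sum>i\<in>{1..n}. \<bar>?U i X - S.expectation (?U i)\<bar>)"
      using int by (intro Bochner_Integration.integrable_sum) simp
  qed
  also have "\<dots> = (\<Sum>i\<in>{1..n}. S.expectation (\<lambda>X. \<bar>?U i X - S.expectation (?U i)\<bar>))"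
    using int by (intro Bochner_Integration.integral_sum) simp
  also have "\<dots> \<le> real n * (2 * b)"
    using sum_bounded_above[of "{1..n}" "\<lambda>i. S.expectation (\<lambda>X. \<bar>?U i X - S.expectation (?U i)\<bar>)" "2 * b"] dev
    by simp
  finally show ?thesis by (simp add: b_def)
qed

section \<open>Quantiles and uniform increase of the CDF\<close>

lemma cdf_1: "cdf D 1 = 1"
  unfolding cdf_def using AE_unit sets_eq_imp_space_eq[OF sets_D]
  by (intro prob_eq_1[THEN iffD2]) (auto simp: sets_D elim: eventually_mono)

lemma cdf_eq_0:
  assumes "t < 0"
  shows "cdf D t = 0"
proof -
  have "AE x in D. x \<notin> {..t}" using AE_unit by eventually_elim (use assms in auto)
  then show ?thesis unfolding cdf_def by (subst prob_eq_0) (simp_all add: sets_D)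
qed

text \<open>Continuity excludes an atom at 0: the left limit there is 0, since the CDF vanishes at
  negative points.\<close>

lemma cdf_0:
  assumes "continuous_on UNIV (cdf D)"
  shows "cdf D 0 = 0"
proof -
  have "(cdf D \<longlongrightarrow> cdf D 0) (at_left 0)"
    using assms by (auto simp: continuous_on_def intro: filterlim_at_split[THEN iffD1, THEN conjunct1])
  moreover have "(cdf D \<longlongrightarrow> 0) (at_left 0)"
    by (rule tendsto_eventually) (auto simp: eventually_at_filter cdf_eq_0)
  ultimately show ?thesis by (intro tendsto_unique[of "at_left (0::real)"]) auto
qed

lemma ex_quantile:
  assumes "continuous_on UNIV (cdf D)" "v \<in> {0..1}"
  shows "\<exists>q\<in>{0..1}. cdf D q = v"
proof -
  have "\<exists>q\<ge>0. q \<le> 1 \<and> cdf D q = v"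
    using assms(2) cdf_0[OF assms(1)] cdf_1
    by (intro IVT' continuous_on_subset[OF assms(1)]) auto
  then show ?thesis by auto
qed

text \<open>The increment over a window of length \<open>\<delta>\<close> is a continuous function
  of the window's left end on a compact interval, so it attains its minimum, which is positive by
  strict monotonicity.\<close>

lemma ex_uniform_gap:
  assumes cont: "continuous_on UNIV (cdf D)" and "0 < \<delta>" "\<delta> < 1"
    and incr: "\<And>x y. 0 \<le> x \<Longrightarrow> x < y \<Longrightarrow> y \<le> 1 \<Longrightarrow> cdf D x < cdf D y"
  shows "\<exists>\<eta>>0. \<forall>y. 0 \<le> y \<longrightarrow> y + \<delta> \<le> 1 \<longrightarrow> cdf D y + \<eta> \<le> cdf D (y + \<delta>)"
proof -
  have "continuous_on {0..1-\<delta>} (\<lambda>x. cdf D (x + \<delta>) - cdf D x)"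
    by (intro continuous_intros continuous_on_compose2[OF cont]) auto
  then obtain x where "x \<in> {0..1-\<delta>}"
    and x: "\<And>y. y \<in> {0..1-\<delta>} \<Longrightarrow> cdf D (x + \<delta>) - cdf D x \<le> cdf D (y + \<delta>) - cdf D y"
    using continuous_attains_inf[of "{0..1-\<delta>}"] \<open>\<delta> < 1\<close> by force
  then have "cdf D x < cdf D (x + \<delta>)" using incr[of x "x + \<delta>"] \<open>0 < \<delta>\<close> by simp
  moreover have "cdf D y + (cdf D (x + \<delta>) - cdf D x) \<le> cdf D (y + \<delta>)" if "0 \<le> y" "y + \<delta> \<le> 1" for y
    using x[of y] that by simp
  ultimately show ?thesis by (intro exI[of _ "cdf D (x + \<delta>) - cdf D x"]) auto
qed

lemma ewm_many_alternatives:
  assumes cont: "continuous_on UNIV (cdf D)"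
    and incr: "\<And>x y. 0 \<le> x \<Longrightarrow> x < y \<Longrightarrow> y \<le> 1 \<Longrightarrow> cdf D x < cdf D y"
    and "\<epsilon> > 0"
  shows "\<exists>m0. \<forall>m\<ge>m0. \<forall>n \<sigma> f. is_profile n m \<sigma> \<longrightarrow> ewm_rule D n m f \<longrightarrow>
    (1 - \<epsilon>) * Max ((\<lambda>j. exp_dist D n m \<sigma> j) ` {1..m}) \<le> exp_dist D n m \<sigma> (f \<sigma>)"
proof (cases "\<mu> > 0")
  case True
  \<comment> \<open>The deviation per voter will be at most
    \<open>2 * (\<delta> + \<delta>)\<close>, which 16 fits into
    \<open>\<epsilon> * \<mu>\<^sup>2 / 4\<close>. The cap \<open>1 / 2\<close> ensures
    \<open>\<delta> < 1\<close> for \<open>ex_uniform_gap\<close>.\<close>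
  define \<delta> where "\<delta> = min (\<epsilon> * \<mu>\<^sup>2 / 16) (1 / 2)"
  have \<delta>: "0 < \<delta>" "\<delta> < 1" "4 * \<delta> \<le> \<epsilon> * \<mu>\<^sup>2 / 4"
    using True \<open>\<epsilon> > 0\<close> by (auto simp: \<delta>_def min_def)
  obtain \<eta> where "\<eta> > 0" and gap: "\<And>y. 0 \<le> y \<Longrightarrow> y + \<delta> \<le> 1 \<Longrightarrow> cdf D y + \<eta> \<le> cdf D (y + \<delta>)"
    using ex_uniform_gap[OF cont \<delta>(1,2) incr] by blast
  obtain m0 where m0: "\<And>m. m \<ge> m0 \<Longrightarrow> 4 * exp (- 2 * real m * \<eta>\<^sup>2) \<le> \<delta>"
    using exp_tail_le[OF \<open>0 < \<delta>\<close> \<open>\<eta> > 0\<close>] by blast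
  have "(1 - \<epsilon>) * Max ((\<lambda>j. exp_dist D n m \<sigma> j) ` {1..m}) \<le> exp_dist D n m \<sigma> (f \<sigma>)"
    if "m \<ge> m0" "is_profile n m \<sigma>" "ewm_rule D n m f" for n m \<sigma> f
  proof (rule exp_dist_ewm_ge[OF that(2,3) \<open>\<epsilon> > 0\<close>])
    fix j assume j: "j \<in> {1..m}"
    have "(\<integral>X. \<bar>sw n m \<sigma> X j - exp_sw D n m \<sigma> j\<bar> \<partial>sample_space D n m)
        \<le> real n * (2 * (\<delta> + 4 * exp (- 2 * real m * \<eta>\<^sup>2)))"
      using \<delta> \<open>\<eta> > 0\<close>
      by (intro sw_deviation_many_alternatives[OF that(2) j gap _ _ ex_quantile[OF cont]]) auto
    also have "\<dots> \<le> real n * (\<epsilon> * \<mu>\<^sup>2 / 4)"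
      using m0[OF \<open>m \<ge> m0\<close>] \<delta>(3) by (intro mult_left_mono) auto
    finally show "(\<integral>X. \<bar>sw n m \<sigma> X j - exp_sw D n m \<sigma> j\<bar> \<partial>sample_space D n m) \<le> real n * (\<epsilon> * \<mu>\<^sup>2 / 4)" .
  qed
  then show ?thesis by blast
next
  case False
  \<comment> \<open>Here \<open>0 < real n * \<mu>\<close> fails, so the deviation hypothesis of
    \<open>exp_dist_ewm_ge\<close> is vacuous and every \<open>m\<close> is covered.\<close>
  then have "(1 - \<epsilon>) * Max ((\<lambda>j. exp_dist D n m \<sigma> j) ` {1..m}) \<le> exp_dist D n m \<sigma> (f \<sigma>)"
    if "is_profile n m \<sigma>" "ewm_rule D n m f" for n m \<sigma> f
    by (intro exp_dist_ewm_ge[OF that \<open>\<epsilon> > 0\<close>]) (simp add: zero_less_mult_iff)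
  then show ?thesis by blast
qed

end

section \<open>Positive derivative and strict monotonicity of the CDF\<close>

theorem theorem3:
  fixes D :: "real measure"
  assumes "prob_space D"
    and "sets D = sets borel"
    and "AE x in D. x \<in> {0..1}"
  shows "(\<forall>\<epsilon>>0. \<exists>n0. \<forall>n\<ge>n0. \<forall>m \<sigma> f. is_profile n m \<sigma> \<longrightarrow> ewm_rule D n m f \<longrightarrow>
            exp_dist D n m \<sigma> (f \<sigma>) \<ge> (1 - \<epsilon>) * Max ((\<lambda>j. exp_dist D n m \<sigma> j) ` {1..m}))
       \<and> ((continuous_on UNIV (cdf D) \<and>
            (\<exists>F'. continuous_on {0..1} F' \<and>
                 (\<forall>x\<in>{0..1}. (cdf D has_real_derivative F' x) (at x within {0..1})) \<and>
                 (\<forall>x\<in>{0<..<1}. F' x > 0)))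
          \<longrightarrow> (\<forall>\<epsilon>>0. \<exists>m0. \<forall>m\<ge>m0. \<forall>n \<sigma> f. is_profile n m \<sigma> \<longrightarrow> ewm_rule D n m f \<longrightarrow>
            exp_dist D n m \<sigma> (f \<sigma>) \<ge> (1 - \<epsilon>) * Max ((\<lambda>j. exp_dist D n m \<sigma> j) ` {1..m})))"
proof -
  interpret unit_interval_distribution D
    by (intro unit_interval_distribution.intro unit_interval_distribution_axioms.intro assms)
  have "\<exists>m0. \<forall>m\<ge>m0. \<forall>n \<sigma> f. is_profile n m \<sigma> \<longrightarrow> ewm_rule D n m f \<longrightarrow>
      (1 - \<epsilon>) * Max ((\<lambda>j. exp_dist D n m \<sigma> j) ` {1..m}) \<le> exp_dist D n m \<sigma> (f \<sigma>)"
    if cont: "continuous_on UNIV (cdf D)"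
      and deriv: "\<forall>x\<in>{0..1}. (cdf D has_real_derivative F' x) (at x within {0..1})"
      and pos: "\<forall>x\<in>{0<..<1}. F' x > 0" and "\<epsilon> > 0" for F' \<epsilon>
  proof (rule ewm_many_alternatives[OF cont _ \<open>\<epsilon> > 0\<close>])
    fix x y :: real assume xy: "0 \<le> x" "x < y" "y \<le> 1"
    show "cdf D x < cdf D y"
    proof (rule DERIV_pos_imp_increasing_open[OF \<open>x < y\<close>])
      fix z assume "x < z" "z < y"
      then have z: "z \<in> {0<..<1}" using xy by simp
      then have "at z within {0..1} = at z" by (intro at_within_interior) simp
      moreover have "(cdf D has_real_derivative F' z) (at z within {0..1})"
        using deriv z by simp
      ultimately show "\<exists>d. (cdf D has_real_derivative d) (at z) \<and> d > 0"
        using bspec[OF pos z] by metis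
    qed (rule continuous_on_subset[OF cont subset_UNIV])
  qed
  then show ?thesis using ewm_many_voters by blast
qed

end
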